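(* Let $r\ge 1$, let $n_1,\dots,n_{2r}$ be positive integers, let $\mathcal{A}=(a_{i_1,\dots,i_{2r}})\in\mathbb{R}^{n_1\times\cdots\times n_{2r}}$ be a hypermatrix, and let $A$ be the $\big(\prod_{s=1}^r n_s\big)\times\big(\prod_{s=1}^{r} n_{r+s}\big)$ matrix obtained by arranging $\mathcal{A}$ with rows labeled by $(i_1,\dots,i_r)$ and columns labeled by $(i_{r+1},\dots,i_{2r})$, both in lexicographic order. Let $A_s$ be a real $n_s\times n_{r+s}$ matrix, $s=1,\dots,r$, and let $\sigma$ be the permutation of $\{1,\dots,2r\}$ given by $(\sigma(1),\sigma(2),\dots,\sigma(2r))=(1,r+1,2,r+2,\dots,r,2r)$. Then $$A=A_1\otimes A_2\otimes\cdots\otimes A_r$$ if and only if $$W^{\sigma}_{[n_1,n_2,\dots,n_{2r}]}\,V_r(A)=V_r(A_1)\otimes V_r(A_2)\otimes\cdots\otimes V_r(A_r).$$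
   Context: A hypermatrix $\mathcal{A}=(a_{i_1,\dots,i_{2r}})\in\mathbb{R}^{n_1\times\cdots\times n_{2r}}$ is a real array indexed by $i_s\in\{1,\dots,n_s\}$. $\otimes$ is the Kronecker product (for column vectors it coincides with the semi-tensor product $\ltimes$ used in the paper). For a matrix $M$, $V_r(M)$ is its row stacking form: the column vector obtained by listing the entries of $M$ row by row. For positive integers $n_1,\dots,n_d$ with $n=\prod_{s=1}^d n_s$ and a permutation $\sigma$ of $\{1,\dots,d\}$, the permutation matrix $W^{\sigma}_{[n_1,\dots,n_d]}$ is the unique $n\times n$ real matrix such that $W^{\sigma}_{[n_1,\dots,n_d]}(x_1\otimes\cdots\otimes x_d)=x_{\sigma(1)}\otimes\cdots\otimes x_{\sigma(d)}$ for all $x_s\in\mathbb{R}^{n_s}$, $s=1,\dots,d$. *)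

theory Defs
  imports "Jordan_Normal_Form.Matrix" "HOL-Combinatorics.Permutations"
begin

section \<open>Kronecker products\<close>

definition kron_mat :: "'a::semiring_1 mat \<Rightarrow> 'a mat \<Rightarrow> 'a mat" where
  "kron_mat A B = mat (dim_row A * dim_row B) (dim_col A * dim_col B)
     (\<lambda>(i, j). A $$ (i div dim_row B, j div dim_col B) * B $$ (i mod dim_row B, j mod dim_col B))"

definition kron_vec :: "'a::semiring_1 vec \<Rightarrow> 'a vec \<Rightarrow> 'a vec" where
  "kron_vec x y = vec (dim_vec x * dim_vec y)
     (\<lambda>i. x $ (i div dim_vec y) * y $ (i mod dim_vec y))"

definition kron_mats :: "'a::semiring_1 mat list \<Rightarrow> 'a mat" where
  "kron_mats Ms = foldr kron_mat Ms (1\<^sub>m 1)"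

definition kron_vecs :: "'a::semiring_1 vec list \<Rightarrow> 'a vec" where
  "kron_vecs xs = foldr kron_vec xs (vec 1 (\<lambda>_. 1))"

text \<open>On column vectors, \<open>kron_vec\<close> is the Kronecker product of the corresponding
  one-column matrices.\<close>

lemma kron_mat_mat_of_cols:
  "kron_mat (mat_of_cols (dim_vec x) [x]) (mat_of_cols (dim_vec y) [y])
     = mat_of_cols (dim_vec x * dim_vec y) [kron_vec x y]"
proof (rule eq_matI)
  fix i j
  assume "i < dim_row (mat_of_cols (dim_vec x * dim_vec y) [kron_vec x y])"
    and "j < dim_col (mat_of_cols (dim_vec x * dim_vec y) [kron_vec x y])"
  then have i: "i < dim_vec x * dim_vec y" and j: "j = 0" by auto
  have y: "0 < dim_vec y" using i by (cases "dim_vec y") auto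
  have "i div dim_vec y < dim_vec x" using i by (simp add: less_mult_imp_div_less)
  moreover have "i mod dim_vec y < dim_vec y" using y by simp
  ultimately show "kron_mat (mat_of_cols (dim_vec x) [x]) (mat_of_cols (dim_vec y) [y]) $$ (i, j)
      = mat_of_cols (dim_vec x * dim_vec y) [kron_vec x y] $$ (i, j)"
    using i j by (simp add: kron_mat_def kron_vec_def mat_of_cols_index)
qed (auto simp: kron_mat_def)

lemma kron_mats_singleton: "kron_mats [A] = A"
  by (rule eq_matI) (auto simp: kron_mats_def kron_mat_def)

lemma kron_vecs_singleton: "kron_vecs [x] = x"
  by (rule eq_vecI) (auto simp: kron_vecs_def kron_vec_def)


section \<open>Row stacking\<close>

definition row_stack :: "'a mat \<Rightarrow> 'a vec" where
  "row_stack M = vec_of_list (concat (mat_to_list M))"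


section \<open>Hypermatrices and their matrix arrangement\<close>

text \<open>All multi-indices \<open>[i\<^sub>1, \<dots>, i\<^sub>k]\<close> with \<open>1 \<le> i\<^sub>s \<le> ns ! (s - 1)\<close>, in lexicographic order.\<close>

definition multi_indices :: "nat list \<Rightarrow> nat list list" where
  "multi_indices ns = product_lists (map (\<lambda>m. [1..<Suc m]) ns)"

lemma length_multi_indices: "length (multi_indices ns) = prod_list ns"
proof -
  have "(\<lambda>x. length (map (Cons x) xs)) = (\<lambda>_. length xs)" for x :: nat and xs :: "nat list list"
    by simp
  then show ?thesis
    by (induction ns) (auto simp: multi_indices_def length_concat o_def sum_list_triv simp del: upt_Suc)
qed

lemma sorted_multi_indices:
  "sorted_wrt (\<lambda>u v. (u, v) \<in> lexord {(i, j). i < j}) (multi_indices ns)"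
proof (induction ns)
  case Nil
  then show ?case by (simp add: multi_indices_def)
next
  case (Cons m ns)
  have "sorted_wrt (\<lambda>u v. (u, v) \<in> lexord {(i, j). i < j})
      (concat (map (\<lambda>x. map (Cons x) (multi_indices ns)) xs))"
    if "sorted_wrt (<) xs" for xs :: "nat list"
    using that Cons.IH by (induction xs) (auto simp: sorted_wrt_append sorted_wrt_map)
  from this[of "[1..<Suc m]"] show ?case
    by (simp add: multi_indices_def del: upt_Suc)
qed

text \<open>A hypermatrix is a function \<open>a\<close> on multi-indices; only its values on multi-indices within
  the bounds are used. Rows are labelled by the multi-indices bounded by \<open>ns\<close>, columns by
  those bounded by \<open>ms\<close>.\<close>

definition arrange_mat :: "nat list \<Rightarrow> nat list \<Rightarrow> (nat list \<Rightarrow> 'a) \<Rightarrow> 'a mat" where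
  "arrange_mat ns ms a = mat (prod_list ns) (prod_list ms)
     (\<lambda>(i, j). a (multi_indices ns ! i @ multi_indices ms ! j))"


section \<open>The permutation matrix of a Kronecker product\<close>

definition kron_perm_mat :: "nat \<Rightarrow> (nat \<Rightarrow> nat) \<Rightarrow> (nat \<Rightarrow> nat) \<Rightarrow> real mat" where
  "kron_perm_mat d n \<sigma> = (THE W.
     W \<in> carrier_mat (\<Prod>s = 1..d. n s) (\<Prod>s = 1..d. n s) \<and>
     (\<forall>x. (\<forall>s\<in>{1..d}. x s \<in> carrier_vec (n s)) \<longrightarrow>
       W *\<^sub>v kron_vecs (map x [1..<Suc d]) = kron_vecs (map (\<lambda>s. x (\<sigma> s)) [1..<Suc d])))"

end

theory Submission
  imports Defs
begin

text \<open>
  Both sides of the equivalence say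
  \<open>a(i\<^sub>1, \<dots>, i\<^sub>2\<^sub>r) = A\<^sub>1(i\<^sub>1, i\<^sub>r\<^sub>+\<^sub>1) \<cdots> A\<^sub>r(i\<^sub>r, i\<^sub>2\<^sub>r)\<close> for all multi-indices; they only list these
  equations in different orders. To make this precise, a multi-index is a function \<open>i\<close> on a set
  of axes, and \<open>lex_pos n ss i\<close> is its position in the lexicographic order in which the axes have
  the significance prescribed by the list \<open>ss\<close>. Permuting tensor factors then changes the list of
  axes and leaves the multi-index \<open>i\<close> alone.

  Kronecker products of vectors (\<open>kron_vecs_lex_pos\<close>) and of matrices (\<open>kron_mats_lex_pos\<close>) have as
  their entry at a lexicographic position the product of the corresponding entries of the factors.
  Row stacking appends the column axes to the row axes (\<open>row_stack_lex_pos\<close>). The permutation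
  matrix moves the entry at \<open>lex_pos n [1..<Suc d] i\<close> to \<open>lex_pos n (map \<sigma> [1..<Suc d]) i\<close>
  (\<open>kron_perm_mat_lex_pos\<close>). In the theorem \<open>\<sigma>\<close> arranges the axes as \<open>1, r + 1, 2, r + 2, \<dots>\<close>, which
  is the order in which the axes occur in the product of the row stackings of the \<open>A\<^sub>s\<close>. Since every
  entry of a vector is at the position of some multi-index (\<open>lex_pos_surj\<close>), comparing entries
  proves the equivalence.
\<close>

section \<open>Lexicographic positions of multi-indices\<close>

text \<open>Digits and bases are functions of the axis, so that one multi-index \<open>i\<close> can be read along
  several orderings \<open>ss\<close> of the same axes; for fixed \<open>ss\<close> this is the mixed-radix numeral with the
  digit of the first axis most significant. Digits start at 0, like the
  indices of vectors and matrices.\<close>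

fun lex_pos :: "('b \<Rightarrow> nat) \<Rightarrow> 'b list \<Rightarrow> ('b \<Rightarrow> nat) \<Rightarrow> nat" where
  "lex_pos n [] i = 0"
| "lex_pos n (s # ss) i = i s * prod_list (map n ss) + lex_pos n ss i"

lemma mult_add_less_mult:
  fixes p q k m :: nat
  assumes "p < k" "q < m"
  shows "p * m + q < k * m"
proof -
  have "p * m + q < Suc p * m" using assms by simp
  also have "\<dots> \<le> k * m" using assms by (intro mult_le_mono) auto
  finally show ?thesis .
qed

lemma mult_add_div_mod:
  fixes p q m :: nat
  assumes "q < m"
  shows "(p * m + q) div m = p" "(p * m + q) mod m = q"
proof -
  have "m \<noteq> 0" using assms by (cases m) simp_all
  then show "(p * m + q) div m = p"
    using assms by (metis div_mult_self3 div_less add_0_right)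
  show "(p * m + q) mod m = q"
    using assms by (metis mod_mult_self3 mod_less)
qed

lemma lex_pos_less:
  "\<forall>s\<in>set ss. i s < n s \<Longrightarrow> lex_pos n ss i < prod_list (map n ss)"
  by (induction ss) (auto intro: mult_add_less_mult)

lemma lex_pos_append:
  "lex_pos n (ss @ ts) i = lex_pos n ss i * prod_list (map n ts) + lex_pos n ts i"
  by (induction ss) (auto simp: algebra_simps)

lemma lex_pos_map: "lex_pos n (map f ss) i = lex_pos (n \<circ> f) ss (i \<circ> f)"
  by (induction ss) (simp_all add: o_def)

text \<open>Consecutive axes can be grouped into blocks, each of which is then read as a single digit. This
  is what lets each row stacking, with its two axes, act as one factor of a Kronecker product.\<close>

lemma lex_pos_concat:
  "lex_pos n (concat (map f ss)) i =
     lex_pos (\<lambda>s. prod_list (map n (f s))) ss (\<lambda>s. lex_pos n (f s) i)"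
proof -
  have "prod_list (map n (concat (map f ts))) = prod_list (map (\<lambda>s. prod_list (map n (f s))) ts)"
    for ts by (induction ts) auto
  then show ?thesis by (induction ss) (auto simp: lex_pos_append)
qed

lemma lex_pos_inj:
  assumes "\<forall>s\<in>set ss. i s < n s" "\<forall>s\<in>set ss. j s < n s"
    and "lex_pos n ss i = lex_pos n ss j"
  shows "\<forall>s\<in>set ss. i s = j s"
  using assms
proof (induction ss)
  case (Cons s ss)
  let ?m = "prod_list (map n ss)"
  have i: "lex_pos n ss i < ?m" and j: "lex_pos n ss j < ?m"
    using Cons.prems by (auto intro: lex_pos_less)
  have eq: "i s * ?m + lex_pos n ss i = j s * ?m + lex_pos n ss j"
    using Cons.prems(3) by simp
  have "i s = j s"
    using mult_add_div_mod(1)[OF i, of "i s"] mult_add_div_mod(1)[OF j, of "j s"] eq by metis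
  moreover from this have "lex_pos n ss i = lex_pos n ss j" using eq by simp
  then have "\<forall>s\<in>set ss. i s = j s" using Cons.prems(1,2) by (intro Cons.IH) simp_all
  ultimately show ?case by simp
qed simp

lemma lex_pos_surj:
  assumes "distinct ss" "p < prod_list (map n ss)"
  shows "\<exists>i. (\<forall>s\<in>set ss. i s < n s) \<and> lex_pos n ss i = p"
  using assms
proof (induction ss arbitrary: p)
  case (Cons s ss)
  let ?m = "prod_list (map n ss)"
  have p: "p < n s * ?m" using Cons.prems by simp
  then have "0 < ?m" by (cases "?m") auto
  then have "p mod ?m < ?m" by simp
  with Cons obtain i where i: "\<forall>t\<in>set ss. i t < n t" "lex_pos n ss i = p mod ?m"
    by auto
  let ?i = "i(s := p div ?m)"
  have "lex_pos n ts ?i = lex_pos n ts i" if "s \<notin> set ts" for ts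
    using that by (induction ts) auto
  then have "lex_pos n (s # ss) ?i = p"
    using i Cons.prems by simp
  moreover have "\<forall>t\<in>set (s # ss). ?i t < n t"
    using i p by (auto simp: less_mult_imp_div_less)
  ultimately show ?case by blast
qed simp

lemma vec_eq_iff_lex_pos:
  assumes "distinct ss"
    and "v \<in> carrier_vec (prod_list (map n ss))" "w \<in> carrier_vec (prod_list (map n ss))"
  shows "v = w \<longleftrightarrow>
    (\<forall>i. (\<forall>s\<in>set ss. i s < n s) \<longrightarrow> v $ lex_pos n ss i = w $ lex_pos n ss i)"
proof
  assume *: "\<forall>i. (\<forall>s\<in>set ss. i s < n s) \<longrightarrow> v $ lex_pos n ss i = w $ lex_pos n ss i"
  show "v = w"
  proof (rule eq_vecI)
    fix p assume "p < dim_vec w"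
    then have "p < prod_list (map n ss)" using assms by simp
    then show "v $ p = w $ p" using lex_pos_surj[OF assms(1)] * by metis
  qed (use assms in simp)
qed simp


section \<open>Entries of Kronecker products and row stackings\<close>

lemma dim_kron_vecs: "dim_vec (kron_vecs xs) = prod_list (map dim_vec xs)"
  by (induction xs) (auto simp: kron_vecs_def kron_vec_def)

lemma kron_vecs_carrier:
  assumes "\<forall>s\<in>set ss. x s \<in> carrier_vec (n s)"
  shows "kron_vecs (map x ss) \<in> carrier_vec (prod_list (map n ss))"
proof -
  have "map dim_vec (map x ss) = map n ss" using assms by auto
  then show ?thesis by (metis carrier_vecI dim_kron_vecs)
qed

lemma kron_vecs_lex_pos:
  assumes "\<forall>s\<in>set ss. x s \<in> carrier_vec (n s)" "\<forall>s\<in>set ss. i s < n s"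
  shows "kron_vecs (map x ss) $ lex_pos n ss i = prod_list (map (\<lambda>s. x s $ i s) ss)"
  using assms
proof (induction ss)
  case Nil
  then show ?case by (simp add: kron_vecs_def)
next
  case (Cons s ss)
  let ?m = "prod_list (map n ss)"
  have less: "lex_pos n ss i < ?m" using Cons.prems by (auto intro: lex_pos_less)
  have "dim_vec (kron_vecs (map x ss)) = ?m"
    using Cons.prems kron_vecs_carrier[of ss x n] by auto
  moreover have "kron_vecs (map x (s # ss)) = kron_vec (x s) (kron_vecs (map x ss))"
    by (simp add: kron_vecs_def)
  moreover have "i s * ?m + lex_pos n ss i < n s * ?m"
    using Cons.prems less by (auto intro: mult_add_less_mult)
  moreover have "dim_vec (x s) = n s" using Cons.prems by auto
  ultimately show ?case using Cons less by (simp add: kron_vec_def mult_add_div_mod)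
qed

lemma kron_mats_carrier:
  assumes "\<forall>s\<in>set ss. M s \<in> carrier_mat (n s) (m s)"
  shows "kron_mats (map M ss) \<in> carrier_mat (prod_list (map n ss)) (prod_list (map m ss))"
  using assms by (induction ss) (auto simp: kron_mats_def kron_mat_def)

lemma kron_mats_lex_pos:
  assumes "\<forall>s\<in>set ss. M s \<in> carrier_mat (n s) (m s)"
    and "\<forall>s\<in>set ss. i s < n s" "\<forall>s\<in>set ss. j s < m s"
  shows "kron_mats (map M ss) $$ (lex_pos n ss i, lex_pos m ss j) =
    prod_list (map (\<lambda>s. M s $$ (i s, j s)) ss)"
  using assms
proof (induction ss)
  case Nil
  then show ?case by (simp add: kron_mats_def)
next
  case (Cons s ss)
  let ?n = "prod_list (map n ss)" and ?m = "prod_list (map m ss)"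
  have less: "lex_pos n ss i < ?n" "lex_pos m ss j < ?m"
    using Cons.prems by (auto intro: lex_pos_less)
  have "dim_row (kron_mats (map M ss)) = ?n" "dim_col (kron_mats (map M ss)) = ?m"
    using Cons.prems kron_mats_carrier[of ss M n m] by auto
  moreover have "kron_mats (map M (s # ss)) = kron_mat (M s) (kron_mats (map M ss))"
    by (simp add: kron_mats_def)
  moreover have "i s * ?n + lex_pos n ss i < n s * ?n" "j s * ?m + lex_pos m ss j < m s * ?m"
    using Cons.prems less by (auto intro: mult_add_less_mult)
  moreover have "dim_row (M s) = n s" "dim_col (M s) = m s" using Cons.prems by auto
  ultimately show ?case using Cons less by (simp add: kron_mat_def mult_add_div_mod)
qed

lemma nth_concat_uniform:
  assumes "\<forall>xs\<in>set xss. length xs = c" "p < length xss" "q < c"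
  shows "concat xss ! (p * c + q) = xss ! p ! q"
  using assms
proof (induction xss arbitrary: p)
  case (Cons xs xss)
  show ?case
  proof (cases p)
    case 0
    have "q < length xs" using Cons.prems by simp
    then show ?thesis by (simp only: 0 concat.simps nth_append nth_Cons_0) simp
  next
    case (Suc p')
    have "length xs = c" using Cons.prems by simp
    moreover have "concat xss ! (p' * c + q) = xss ! p' ! q"
      using Cons.prems Suc by (intro Cons.IH) simp_all
    moreover have "Suc p' * c + q = c + (p' * c + q)" by simp
    ultimately show ?thesis
      by (metis Suc concat.simps(2) nth_append_length_plus nth_Cons_Suc)
  qed
qed simp

lemma row_stack_carrier:
  assumes "M \<in> carrier_mat k l"
  shows "row_stack M \<in> carrier_vec (k * l)"
proof (rule carrier_vecI)
  have "map length (mat_to_list M) = map (\<lambda>_. l) [0..<k]"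
    using assms by (simp add: mat_to_list_def)
  then have "length (concat (mat_to_list M)) = k * l"
    by (simp only: length_concat sum_list_triv length_upt) simp
  then show "dim_vec (row_stack M) = k * l"
    by (simp add: row_stack_def)
qed

lemma row_stack_nth:
  assumes "M \<in> carrier_mat k l" "p < k" "q < l"
  shows "row_stack M $ (p * l + q) = M $$ (p, q)"
proof -
  have "concat (mat_to_list M) ! (p * l + q) = mat_to_list M ! p ! q"
    using assms by (intro nth_concat_uniform) (auto simp: mat_to_list_def)
  then show ?thesis using assms by (simp add: row_stack_def mat_to_list_def vec_of_list_index)
qed

lemma row_stack_inject:
  assumes "M \<in> carrier_mat k l" "N \<in> carrier_mat k l"
  shows "row_stack M = row_stack N \<longleftrightarrow> M = N"
proof
  assume eq: "row_stack M = row_stack N"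
  show "M = N"
  proof (rule eq_matI)
    fix p q assume "p < dim_row N" "q < dim_col N"
    then show "M $$ (p, q) = N $$ (p, q)"
      using assms eq row_stack_nth[of _ k l p q] by (metis carrier_matD)
  qed (use assms in auto)
qed simp

lemma row_stack_lex_pos:
  assumes "M \<in> carrier_mat (prod_list (map n ss)) (prod_list (map n ts))"
    and "\<forall>s\<in>set (ss @ ts). i s < n s"
  shows "row_stack M $ lex_pos n (ss @ ts) i = M $$ (lex_pos n ss i, lex_pos n ts i)"
  unfolding lex_pos_append
  by (rule row_stack_nth[OF assms(1)]; rule lex_pos_less) (use assms(2) in simp_all)


section \<open>The permutation matrix moves entries between lexicographic positions\<close>

text \<open>Standard basis vectors are pure tensors; this is why a matrix is determined by its action
  on pure tensors.\<close>

lemma kron_vecs_unit_vec: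
  assumes "distinct ss" "\<forall>s\<in>set ss. i s < n s"
  shows "kron_vecs (map (\<lambda>s. unit_vec (n s) (i s)) ss) =
    (unit_vec (prod_list (map n ss)) (lex_pos n ss i) :: 'a::semiring_1 vec)"
proof -
  \<comment> \<open>The entry at the position of \<open>j\<close> is a product of Kronecker deltas.\<close>
  have "kron_vecs (map (\<lambda>s. unit_vec (n s) (i s)) ss) $ lex_pos n ss j =
      (unit_vec (prod_list (map n ss)) (lex_pos n ss i) :: 'a vec) $ lex_pos n ss j"
    if j: "\<forall>s\<in>set ss. j s < n s" for j
  proof -
    have "prod_list (map (\<lambda>s. (unit_vec (n s) (i s) :: 'a vec) $ j s) ss) =
        (if \<forall>s\<in>set ss. i s = j s then 1 else 0)"
      using j assms(2) by (induction ss) auto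
    moreover have "lex_pos n ss i = lex_pos n ss j \<longleftrightarrow> (\<forall>s\<in>set ss. i s = j s)"
    proof
      show "lex_pos n ss i = lex_pos n ss j" if "\<forall>s\<in>set ss. i s = j s"
        using that by (induction ss) auto
    qed (use lex_pos_inj[OF assms(2) j] in blast)
    ultimately show ?thesis
      using j assms lex_pos_less[OF j] lex_pos_less[OF assms(2)]
      by (subst kron_vecs_lex_pos) auto
  qed
  then show ?thesis
    using assms by (subst vec_eq_iff_lex_pos[of ss _ n]) (auto intro: kron_vecs_carrier)
qed

lemma mult_mat_unit_vec:
  fixes M :: "'a::semiring_1 mat"
  assumes "M \<in> carrier_mat k l" "q < l"
  shows "M *\<^sub>v unit_vec l q = col M q"
  using assms by (intro eq_vecI) auto

text \<open>The permutation that sends the position of a multi-index in the original order of the axes to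
  its position in the permuted order gives a matrix with the required action on pure tensors. It is
  the only one because the basis vectors are pure tensors, so it is the matrix
  that \<open>kron_perm_mat\<close> describes.\<close>

lemma kron_perm_mat:
  fixes n \<sigma> :: "nat \<Rightarrow> nat" and d :: nat
  defines "ss \<equiv> [1..<Suc d]"
  defines "N \<equiv> prod_list (map n ss)"
  assumes \<sigma>: "\<sigma> permutes {1..d}"
  shows kron_perm_mat_carrier: "kron_perm_mat d n \<sigma> \<in> carrier_mat N N"
    and kron_perm_mat_lex_pos:
      "\<And>v i. \<lbrakk>v \<in> carrier_vec N; \<forall>s\<in>set ss. i s < n s\<rbrakk> \<Longrightarrow>
        (kron_perm_mat d n \<sigma> *\<^sub>v v) $ lex_pos n (map \<sigma> ss) i = v $ lex_pos n ss i"
proof -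
  have set_ss: "set ss = {1..d}" and dist: "distinct ss"
    by (auto simp: ss_def)
  let ?ts = "map \<sigma> ss"
  have set_ts: "set ?ts = set ss"
    using permutes_image[OF \<sigma>] by (simp add: set_ss)
  have dist_ts: "distinct ?ts"
    using dist permutes_inj_on[OF \<sigma>] by (simp add: distinct_map)
  have "mset ?ts = mset ss"
    using set_ts dist_ts dist by (metis set_eq_iff_mset_eq_distinct)
  then have prod_ts: "prod_list (map f ?ts) = prod_list (map f ss)"
    for f :: "nat \<Rightarrow> 'b::comm_monoid_mult"
    by (metis mset_map prod_mset_prod_list)
  have N_prod: "(\<Prod>s = 1..d. n s) = N"
    using prod.distinct_set_conv_list[OF dist, of n] by (simp add: N_def set_ss)

  \<comment> \<open>\<open>g\<close> reads a multi-index off its position in the permuted order and returns its position in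
    the original order; the permutation matrix is the matrix of \<open>v \<mapsto> v \<circ> g\<close>.\<close>
  define g where "g p = lex_pos n ss (SOME i. (\<forall>s\<in>set ss. i s < n s) \<and> lex_pos n ?ts i = p)" for p
  define P :: "real mat" where "P = mat N N (\<lambda>(p, q). if q = g p then 1 else 0)"
  have P: "P \<in> carrier_mat N N" by (simp add: P_def)
  have lex_pos_cong: "lex_pos n us i = lex_pos n us j" if "\<forall>s\<in>set us. i s = j s" for us i j
    using that by (induction us) auto
  have g: "g (lex_pos n ?ts i) = lex_pos n ss i" if i: "\<forall>s\<in>set ss. i s < n s" for i
  proof -
    let ?P = "\<lambda>j. (\<forall>s\<in>set ss. j s < n s) \<and> lex_pos n ?ts j = lex_pos n ?ts i"
    have "?P (SOME j. ?P j)" by (rule someI[of ?P i]) (use i in simp)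
    then have "\<forall>s\<in>set ?ts. (SOME j. ?P j) s = i s"
      using i by (intro lex_pos_inj[of _ _ n]) (auto simp only: set_ts)
    then show ?thesis unfolding g_def by (intro lex_pos_cong) (simp only: set_ts)
  qed
  have P_lex_pos: "(P *\<^sub>v v) $ lex_pos n ?ts i = v $ lex_pos n ss i"
    if v: "v \<in> carrier_vec N" and i: "\<forall>s\<in>set ss. i s < n s" for v i
  proof -
    have 1: "lex_pos n ?ts i < N"
      using lex_pos_less[of ?ts i n] i prod_ts[of n] set_ts unfolding N_def by metis
    have 2: "lex_pos n ss i < N"
      using lex_pos_less[OF i] by (simp add: N_def)
    have "(P *\<^sub>v v) $ lex_pos n ?ts i = (\<Sum>q = 0..<N. (if q = lex_pos n ss i then 1 else 0) * v $ q)"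
      using 1 v g[OF i] by (auto simp: P_def scalar_prod_def intro!: sum.cong)
    also have "\<dots> = v $ lex_pos n ss i"
      using 2 by (simp add: if_distrib[where f = "\<lambda>x. x * _"] cong: if_cong)
    finally show ?thesis .
  qed
  have P_kron: "P *\<^sub>v kron_vecs (map x ss) = kron_vecs (map (\<lambda>s. x (\<sigma> s)) ss)"
    if x: "\<forall>s\<in>{1..d}. x s \<in> carrier_vec (n s)" for x :: "nat \<Rightarrow> real vec"
  proof -
    have xs: "\<forall>s\<in>set ss. x s \<in> carrier_vec (n s)" using x by (simp add: set_ss)
    then have xt: "\<forall>s\<in>set ?ts. x s \<in> carrier_vec (n s)" by (simp only: set_ts)
    have "P *\<^sub>v kron_vecs (map x ss) = kron_vecs (map x ?ts)"
    proof (subst vec_eq_iff_lex_pos[OF dist_ts, of _ n], unfold set_ts prod_ts, goal_cases)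
      case 1
      show ?case
        using P kron_vecs_carrier[OF xs] unfolding N_def by (rule mult_mat_vec_carrier)
    next
      case 2
      then show ?case using kron_vecs_carrier[OF xt] prod_ts[of n] by simp
    next
      case 3
      show ?case
      proof (intro allI impI)
        fix i assume i: "\<forall>s\<in>set ss. i s < n s"
        then have it: "\<forall>s\<in>set ?ts. i s < n s" by (simp only: set_ts)
        show "(P *\<^sub>v kron_vecs (map x ss)) $ lex_pos n ?ts i = kron_vecs (map x ?ts) $ lex_pos n ?ts i"
          using P_lex_pos[OF _ i] kron_vecs_carrier[OF xs] kron_vecs_lex_pos[OF xs i]
            kron_vecs_lex_pos[OF xt it] prod_ts[of "\<lambda>s. x s $ i s"]
          unfolding N_def by metis
      qed
    qed
    then show ?thesis by (simp add: o_def)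
  qed
  have unique: "W = P" if W: "W \<in> carrier_mat N N"
    and W_kron: "\<forall>x. (\<forall>s\<in>{1..d}. x s \<in> carrier_vec (n s)) \<longrightarrow>
      W *\<^sub>v kron_vecs (map x ss) = kron_vecs (map (\<lambda>s. x (\<sigma> s)) ss)" for W
  proof (rule mat_col_eqI)
    fix q assume "q < dim_col P"
    then have q: "q < N" using P by simp
    then obtain i where i: "\<forall>s\<in>set ss. i s < n s" "lex_pos n ss i = q"
      using lex_pos_surj[OF dist] unfolding N_def by blast
    let ?e = "\<lambda>s. unit_vec (n s) (i s) :: real vec"
    have "kron_vecs (map ?e ss) = unit_vec N q"
      using kron_vecs_unit_vec[OF dist i(1)] i(2) by (simp add: N_def)
    moreover have "W *\<^sub>v kron_vecs (map ?e ss) = P *\<^sub>v kron_vecs (map ?e ss)"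
      using W_kron P_kron[of ?e] by auto
    ultimately show "col W q = col P q"
      using mult_mat_unit_vec[OF W q] mult_mat_unit_vec[OF P q] by simp
  qed (use P W in auto)
  have eq: "kron_perm_mat d n \<sigma> = P"
    unfolding kron_perm_mat_def N_prod ss_def[symmetric]
  proof (rule the_equality, intro conjI allI impI)
    show "P *\<^sub>v kron_vecs (map x ss) = kron_vecs (map (\<lambda>s. x (\<sigma> s)) ss)"
      if "\<forall>s\<in>{1..d}. x s \<in> carrier_vec (n s)" for x
      using that by (rule P_kron)
  qed (rule P, erule conjE, rule unique)
  show "kron_perm_mat d n \<sigma> \<in> carrier_mat N N"
    unfolding eq by (rule P)
  show "(kron_perm_mat d n \<sigma> *\<^sub>v v) $ lex_pos n (map \<sigma> ss) i = v $ lex_pos n ss i"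
    if "v \<in> carrier_vec N" "\<forall>s\<in>set ss. i s < n s" for v i
    unfolding eq using that by (rule P_lex_pos)
qed


section \<open>Kronecker factorisation of a matrix and of its row stacking\<close>

theorem proposition4p2:
  fixes r :: nat
    and n :: "nat \<Rightarrow> nat"
    and a :: "nat list \<Rightarrow> real"
    and A :: "real mat"
    and As :: "nat \<Rightarrow> real mat"
    and \<sigma> :: "nat \<Rightarrow> nat"
  assumes "r \<ge> 1"
    and "\<And>s. s \<in> {1..2 * r} \<Longrightarrow> n s > 0"
    and "A = arrange_mat (map n [1..<Suc r]) (map n [Suc r..<Suc (2 * r)]) a"
    and "\<And>s. s \<in> {1..r} \<Longrightarrow> As s \<in> carrier_mat (n s) (n (r + s))"
    and "\<sigma> permutes {1..2 * r}"
    and "map \<sigma> [1..<Suc (2 * r)] = concat (map (\<lambda>s. [s, r + s]) [1..<Suc r])"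
  shows "A = kron_mats (map As [1..<Suc r]) \<longleftrightarrow>
    kron_perm_mat (2 * r) n \<sigma> *\<^sub>v row_stack A = kron_vecs (map (\<lambda>s. row_stack (As s)) [1..<Suc r])"
proof -
  define rs where "rs = [1..<Suc r]"
  define cs where "cs = [Suc r..<Suc (2 * r)]"
  define ss where "ss = [1..<Suc (2 * r)]"
  \<comment> \<open>the axes in the order in which the tensor factors of
    \<open>row_stack (As 1), \<dots>, row_stack (As r)\<close> use them\<close>
  define ps where "ps = concat (map (\<lambda>s. [s, r + s]) rs)"
  define N where "N = prod_list (map n ss)"
  let ?K = "kron_mats (map As rs)" and ?W = "kron_perm_mat (2 * r) n \<sigma>"
  let ?x = "kron_vecs (map (\<lambda>s. row_stack (As s)) rs)"
  let ?ix = "\<lambda>i. \<forall>s\<in>set ss. i s < n s"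
  have ss: "ss = rs @ cs"
    using upt_add_eq_append[of 1 "Suc r" r] by (simp add: ss_def rs_def cs_def mult_2)
  have cs: "cs = map ((+) r) rs"
    by (rule nth_equalityI) (auto simp: cs_def rs_def simp del: upt_Suc)
  have dist: "distinct ss" by (simp add: ss_def)
  have ps: "ps = map \<sigma> ss" using assms(6) by (simp add: ps_def rs_def ss_def)
  have set_ps: "set ps = set ss"
    by (auto simp: ps_def ss cs)
  have dist_ps: "distinct ps"
    using dist permutes_inj_on[OF assms(5)] by (simp add: ps distinct_map)
  have N_ps: "N = prod_list (map n ps)"
  proof -
    have "mset ps = mset ss" using set_ps dist_ps dist by (metis set_eq_iff_mset_eq_distinct)
    then show ?thesis unfolding N_def by (metis mset_map prod_mset_prod_list)
  qed
  have N_rs: "N = prod_list (map (\<lambda>s. n s * n (r + s)) rs)"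
    unfolding N_ps ps_def by (induction rs) auto
  have A: "A \<in> carrier_mat (prod_list (map n rs)) (prod_list (map n cs))"
    by (simp add: assms(3) arrange_mat_def rs_def cs_def del: upt_Suc)
  have As: "\<forall>s\<in>set rs. As s \<in> carrier_mat (n s) ((n \<circ> (+) r) s)"
    using assms(4) by (auto simp: rs_def)
  have K: "?K \<in> carrier_mat (prod_list (map n rs)) (prod_list (map n cs))"
    using kron_mats_carrier[OF As] by (simp add: cs o_def)
  have stack: "row_stack M \<in> carrier_vec N"
    if "M \<in> carrier_mat (prod_list (map n rs)) (prod_list (map n cs))" for M :: "real mat"
    using row_stack_carrier[OF that] by (simp add: N_def ss)
  have stack_As: "\<forall>s\<in>set rs. row_stack (As s) \<in> carrier_vec (n s * n (r + s))"
    using As by (auto intro: row_stack_carrier)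
  have x: "?x \<in> carrier_vec N"
    using kron_vecs_carrier[OF stack_As] by (simp add: N_rs)
  have W: "?W *\<^sub>v row_stack A \<in> carrier_vec N"
    using kron_perm_mat_carrier[OF assms(5), of n]
    by (simp add: N_def ss_def mult_mat_vec_carrier[OF _ stack[OF A, unfolded N_def ss_def]] del: upt_Suc)

  have K_entry: "row_stack ?K $ lex_pos n ss i = prod_list (map (\<lambda>s. As s $$ (i s, i (r + s))) rs)"
    if i: "?ix i" for i
  proof -
    have "row_stack ?K $ lex_pos n ss i = ?K $$ (lex_pos n rs i, lex_pos n cs i)"
      using row_stack_lex_pos[OF K] i by (simp add: ss)
    also have "\<dots> = ?K $$ (lex_pos n rs i, lex_pos (n \<circ> (+) r) rs (i \<circ> (+) r))"
      by (simp add: cs lex_pos_map)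
    also have "\<dots> = prod_list (map (\<lambda>s. As s $$ (i s, (i \<circ> (+) r) s)) rs)"
      using As i by (intro kron_mats_lex_pos) (auto simp: ss cs)
    finally show ?thesis by simp
  qed
  have x_entry: "?x $ lex_pos n ps i = prod_list (map (\<lambda>s. As s $$ (i s, i (r + s))) rs)"
    if i: "?ix i" for i
  proof -
    \<comment> \<open>In the row stacking of \<open>A\<^sub>s\<close> the two axes \<open>s\<close> and \<open>r + s\<close> form one block, of size
      \<open>n s * n (r + s)\<close>.\<close>
    have block: "i s < n s" "i (r + s) < n (r + s)" if "s \<in> set rs" for s
      using i that by (auto simp: ss cs)
    have "lex_pos n ps i =
        lex_pos (\<lambda>s. n s * n (r + s)) rs (\<lambda>s. i s * n (r + s) + i (r + s))"
      by (simp add: ps_def lex_pos_concat)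
    then have "?x $ lex_pos n ps i =
        prod_list (map (\<lambda>s. row_stack (As s) $ (i s * n (r + s) + i (r + s))) rs)"
      using kron_vecs_lex_pos[OF stack_As] block by (simp add: mult_add_less_mult)
    also have "\<dots> = prod_list (map (\<lambda>s. As s $$ (i s, i (r + s))) rs)"
      using As block by (intro arg_cong[where f = prod_list] map_cong refl row_stack_nth) auto
    finally show ?thesis .
  qed
  have W_entry: "(?W *\<^sub>v row_stack A) $ lex_pos n ps i = row_stack A $ lex_pos n ss i"
    if "?ix i" for i
    using kron_perm_mat_lex_pos[OF assms(5), of "row_stack A" n i] stack[OF A] that
    unfolding ps N_def ss_def by blast

  have "A = ?K \<longleftrightarrow> row_stack A = row_stack ?K"
    using row_stack_inject[OF A K] by simp
  also have "\<dots> \<longleftrightarrow>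
      (\<forall>i. ?ix i \<longrightarrow> row_stack A $ lex_pos n ss i = row_stack ?K $ lex_pos n ss i)"
    using stack[OF A] stack[OF K] by (intro vec_eq_iff_lex_pos dist) (simp_all add: N_def)
  also have "\<dots> \<longleftrightarrow> (\<forall>i. ?ix i \<longrightarrow> (?W *\<^sub>v row_stack A) $ lex_pos n ps i = ?x $ lex_pos n ps i)"
    using K_entry x_entry W_entry by auto
  also have "\<dots> \<longleftrightarrow> ?W *\<^sub>v row_stack A = ?x"
    using vec_eq_iff_lex_pos[OF dist_ps, of "?W *\<^sub>v row_stack A" n ?x] W x
    by (simp add: N_ps set_ps)
  finally show ?thesis by (simp only: rs_def)
qed

end
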